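(* Let $X$ be a Banach space with a normalized Schauder basis $(e_n)_n$ with basis constant $\lambda$. Let $K:(0,\infty)\to\mathbb R$ and $C\ge 1$, and assume that (i) the basis $(e_n)_n$ has the $K(\delta)$-diagonal factorization property, and (ii) the basis $(e_n)_n$ is $C$-strategically reproducible in $X$. Then $(e_n)_n$ has the $\lambda C^2K(\delta)$-factorization property.
   Context: All Banach spaces are real. Let $X$ be a Banach space with a normalized Schauder basis $(e_i)_i$ and biorthogonal functionals $(e_i^* )_i\subset X^*$. Factorization. For $K>0$ and $T:X\to X$ bounded linear, the identity $K$-factors through $T$ if there are bounded linear $R,S:X\to X$ with $\|R\|\|S\|\le K$ and $I=STR$; it almost $K$-factors through $T$ if it $(K+\varepsilon)$-factors through $T$ for all $\varepsilon>0$. An operator $T$ is diagonal if $e_m^*(T(e_k))=0$ for $k\ne m$. Given a function $K:(0,\infty)\to\mathbb R$, $(e_i)_i$ has the $K(\delta)$-diagonal factorization property (resp. the $K(\delta)$-factorization property) if for every $\delta>0$ and every bounded diagonal operator (resp. every bounded linear operator) $T:X\to X$ with $\inf_n|e_n^*(T(e_n))|\ge\delta$, the identity almost $K(\delta)$-factors through $T$. Impartial equivalence. Sequences $(x_i)$, $(y_i)$ in Banach spaces are impartially $C$-equivalent if $\frac1{\sqrt C}\|\sum a_iy_i\|\le\|\sum a_ix_i\|\le\sqrt C\|\sum a_iy_i\|$ for all finitely supported real sequences $(a_i)$. Strategical reproducibility. $\mathrm{cof}(X)$ is the set of closed finite-codimensional subspaces of $X$; $\mathrm{cof}_{w^*}(X^*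 )$ is the set of $w^*$-closed finite-codimensional subspaces of $X^*$. For $C\ge1$, $\eta>0$ the two-player game $\mathrm{Rep}_{(X,(e_i))}(C,\eta)$ is as follows. Before the first turn player (I) chooses a partition $\mathbb N=N_1\cup N_2$. For $k\in\mathbb N$, turn $k$ has three steps. Step 1: player (I) chooses $\eta_k>0$, $W_k\in\mathrm{cof}(X)$, $G_k\in\mathrm{cof}_{w^*}(X^* )$. Step 2: player (II) chooses $i_k\in\{1,2\}$, a finite set $E_k\subset N_{i_k}$ and non-negative reals $(\lambda_i^{(k)})_{i\in E_k}$, $(\mu_i^{(k)})_{i\in E_k}$ with $1-\eta<\sum_{i\in E_k}\lambda_i^{(k)}\mu_i^{(k)}<1+\eta$. Step 3: player (I) chooses signs $(\varepsilon_i^{(k)})_{i\in E_k}\in\{-1,1\}^{E_k}$. Put $x_k=\sum_{i\in E_k}\varepsilon_i^{(k)}\lambda_i^{(k)}e_i$ and $x_k^*=\sum_{i\in E_k}\varepsilon_i^{(k)}\mu_i^{(k)}e_i^*$. Player (II) wins if: (i) $(x_k)_k$ and $(e_k)_k$ are impartially $(C+\eta)$-equivalent; (ii) $(x_k^* )_k$ and $(e_k^* )_k$ are impartially $(C+\eta)$-equivalent; (iii) $\mathrm{dist}(x_k,W_k)<\eta_k$ for all $k$; (iv) $\mathrm{dist}(x_k^*,G_k)<\eta_k$ for all $k$. The basis $(e_i)_i$ is $C$-strategically reproducible in $X$ if for every $\eta>0$ player (II) has a winning strategy in $\mathrm{Rep}_{(X,(e_i))}(C,\eta)$. *)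

theory Defs
  imports "HOL-Analysis.Analysis"
begin

(* Sequences are indexed from 0. The dual space X* is the type of bounded linear
   maps from X to the reals, with the operator norm. *)

definition schauder_basis :: "(nat \<Rightarrow> 'a::banach) \<Rightarrow> bool" where
  "schauder_basis e \<longleftrightarrow> (\<forall>x. \<exists>!a :: nat \<Rightarrow> real. (\<lambda>n. a n *\<^sub>R e n) sums x)"

definition normalized :: "(nat \<Rightarrow> 'a::real_normed_vector) \<Rightarrow> bool" where
  "normalized e \<longleftrightarrow> (\<forall>n. norm (e n) = 1)"

definition biorthogonal ::
    "(nat \<Rightarrow> 'a::real_normed_vector) \<Rightarrow> (nat \<Rightarrow> 'a \<Rightarrow>\<^sub>L real) \<Rightarrow> bool" where
  "biorthogonal e es \<longleftrightarrow> (\<forall>i j. es i (e j) = (if i = j then 1 else 0))"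

(* The supremum of the operator norms of the partial sum projections. For a Schauder
   basis of a Banach space the supremum is over a bounded set; the term n = 0 is 0
   and does not affect it. *)
definition basis_constant ::
    "(nat \<Rightarrow> 'a::real_normed_vector) \<Rightarrow> (nat \<Rightarrow> 'a \<Rightarrow>\<^sub>L real) \<Rightarrow> real" where
  "basis_constant e es = (SUP n. onorm (\<lambda>x. \<Sum>i<n. es i x *\<^sub>R e i))"

definition id_factors_through :: "real \<Rightarrow> ('a::real_normed_vector \<Rightarrow>\<^sub>L 'a) \<Rightarrow> bool" where
  "id_factors_through K T \<longleftrightarrow>
     (\<exists>R S :: 'a \<Rightarrow>\<^sub>L 'a. norm R * norm S \<le> K \<and> id_blinfun = S o\<^sub>L T o\<^sub>L R)"

definition id_almost_factors_through ::
    "real \<Rightarrow> ('a::real_normed_vector \<Rightarrow>\<^sub>L 'a) \<Rightarrow> bool" where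
  "id_almost_factors_through K T \<longleftrightarrow> (\<forall>\<epsilon>>0. id_factors_through (K + \<epsilon>) T)"

definition diagonal_operator ::
    "(nat \<Rightarrow> 'a::real_normed_vector) \<Rightarrow> (nat \<Rightarrow> 'a \<Rightarrow>\<^sub>L real) \<Rightarrow> ('a \<Rightarrow>\<^sub>L 'a) \<Rightarrow> bool" where
  "diagonal_operator e es T \<longleftrightarrow> (\<forall>k m. k \<noteq> m \<longrightarrow> es m (T (e k)) = 0)"

(* In the following two definitions, only the values of K on positive reals matter. *)
definition diagonal_factorization_property ::
    "(nat \<Rightarrow> 'a::real_normed_vector) \<Rightarrow> (nat \<Rightarrow> 'a \<Rightarrow>\<^sub>L real) \<Rightarrow> (real \<Rightarrow> real) \<Rightarrow> bool" where
  "diagonal_factorization_property e es K \<longleftrightarrow>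
     (\<forall>\<delta>>0. \<forall>T. diagonal_operator e es T \<and> (INF n. \<bar>es n (blinfun_apply T (e n))\<bar>) \<ge> \<delta>
        \<longrightarrow> id_almost_factors_through (K \<delta>) T)"

definition factorization_property ::
    "(nat \<Rightarrow> 'a::real_normed_vector) \<Rightarrow> (nat \<Rightarrow> 'a \<Rightarrow>\<^sub>L real) \<Rightarrow> (real \<Rightarrow> real) \<Rightarrow> bool" where
  "factorization_property e es K \<longleftrightarrow>
     (\<forall>\<delta>>0. \<forall>T. (INF n. \<bar>es n (blinfun_apply T (e n))\<bar>) \<ge> \<delta>
        \<longrightarrow> id_almost_factors_through (K \<delta>) T)"

definition impartially_equivalent ::
    "real \<Rightarrow> (nat \<Rightarrow> 'a::real_normed_vector) \<Rightarrow> (nat \<Rightarrow> 'b::real_normed_vector) \<Rightarrow> bool" where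
  "impartially_equivalent C x y \<longleftrightarrow>
     (\<forall>a :: nat \<Rightarrow> real. finite {i. a i \<noteq> 0} \<longrightarrow>
        1 / sqrt C * norm (\<Sum>i | a i \<noteq> 0. a i *\<^sub>R y i) \<le> norm (\<Sum>i | a i \<noteq> 0. a i *\<^sub>R x i) \<and>
        norm (\<Sum>i | a i \<noteq> 0. a i *\<^sub>R x i) \<le> sqrt C * norm (\<Sum>i | a i \<noteq> 0. a i *\<^sub>R y i))"

(* V has finite codimension iff the quotient by V is spanned by finitely many classes. *)
definition finite_codim_subspace :: "'a::real_vector set \<Rightarrow> bool" where
  "finite_codim_subspace V \<longleftrightarrow> subspace V \<and> (\<exists>B. finite B \<and> span (V \<union> B) = UNIV)"

definition cof :: "'a::real_normed_vector set set" where
  "cof = {W. finite_codim_subspace W \<and> closed W}"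

(* On the dual space, the strong operator topology is the topology of pointwise
   convergence, that is, the weak* topology. *)
definition cof_wstar :: "('a::real_normed_vector \<Rightarrow>\<^sub>L real) set set" where
  "cof_wstar = {G. finite_codim_subspace G \<and> closedin strong_operator_topology G}"

(* The moves of player (I) in step 1, of player (II) in step 2 and of player (I) in step 3
   of one turn: (eta, W, G), (i, E, lambda, mu), and the signs. Of lambda, mu and the signs,
   only the values on E are meaningful. *)
type_synonym 'a step1 = "real \<times> 'a set \<times> ('a \<Rightarrow>\<^sub>L real) set"
type_synonym step2 = "nat \<times> nat set \<times> (nat \<Rightarrow> real) \<times> (nat \<Rightarrow> real)"
type_synonym step3 = "nat \<Rightarrow> real"
type_synonym 'a turn = "'a step1 \<times> step2 \<times> step3"

(* A strategy of player (II) answers the partition, the list of all previous turns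
   and the step 1 of the current turn. *)
type_synonym 'a strategy = "nat set \<times> nat set \<Rightarrow> 'a turn list \<Rightarrow> 'a step1 \<Rightarrow> step2"

definition block_vector ::
    "(nat \<Rightarrow> 'b::real_vector) \<Rightarrow> nat set \<Rightarrow> (nat \<Rightarrow> real) \<Rightarrow> (nat \<Rightarrow> real) \<Rightarrow> 'b" where
  "block_vector b E c s = (\<Sum>i\<in>E. (s i * c i) *\<^sub>R b i)"

(* The strategy wins if, in every play where player (I) moves legally and player (II) follows
   the strategy, all moves of player (II) are legal and the four final conditions hold. As player (I)'s moves
   range over all legal sequences, this covers moves reacting to player (II)'s. *)
definition winning_strategy ::
    "(nat \<Rightarrow> 'a::real_normed_vector) \<Rightarrow> (nat \<Rightarrow> 'a \<Rightarrow>\<^sub>L real) \<Rightarrow> real \<Rightarrow> real \<Rightarrow> 'a strategy \<Rightarrow> bool"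
  where
  "winning_strategy e es C \<eta> \<sigma> \<longleftrightarrow>
     (\<forall>N1 N2 tol W G side E lam mu sgns.
        N1 \<union> N2 = UNIV \<and> N1 \<inter> N2 = {} \<and>
        (\<forall>k::nat. tol k > 0 \<and> W k \<in> cof \<and> G k \<in> cof_wstar) \<and>
        (\<forall>k. (side k, E k, lam k, mu k) =
             \<sigma> (N1, N2)
               (map (\<lambda>j. ((tol j, W j, G j), (side j, E j, lam j, mu j), sgns j)) [0..<k])
               (tol k, W k, G k)) \<and>
        (\<forall>k. sgns k \<in> E k \<rightarrow>\<^sub>E {-1, 1})
        \<longrightarrow>
        (\<forall>k. side k \<in> {1, 2} \<and> finite (E k) \<and> E k \<subseteq> (if side k = 1 then N1 else N2) \<and>
             (\<forall>i\<in>E k. lam k i \<ge> 0 \<and> mu k i \<ge> 0) \<and>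
             1 - \<eta> < (\<Sum>i\<in>E k. lam k i * mu k i) \<and> (\<Sum>i\<in>E k. lam k i * mu k i) < 1 + \<eta>) \<and>
        impartially_equivalent (C + \<eta>) (\<lambda>k. block_vector e (E k) (lam k) (sgns k)) e \<and>
        impartially_equivalent (C + \<eta>) (\<lambda>k. block_vector es (E k) (mu k) (sgns k)) es \<and>
        (\<forall>k. infdist (block_vector e (E k) (lam k) (sgns k)) (W k) < tol k) \<and>
        (\<forall>k. infdist (block_vector es (E k) (mu k) (sgns k)) (G k) < tol k))"

definition strategically_reproducible ::
    "(nat \<Rightarrow> 'a::real_normed_vector) \<Rightarrow> (nat \<Rightarrow> 'a \<Rightarrow>\<^sub>L real) \<Rightarrow> real \<Rightarrow> bool" where
  "strategically_reproducible e es C \<longleftrightarrow> (\<forall>\<eta>>0. \<exists>\<sigma>. winning_strategy e es C \<eta> \<sigma>)"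

end

theory Submission
  imports Defs
begin

text \<open>
  Let \<open>T\<close> have diagonal entries of modulus at least \<open>\<delta>\<close>. The plan is to find blocks \<open>x k\<close> of the
  basis and \<open>xs k\<close> of the biorthogonal functionals such that the matrix of \<open>T\<close> with respect to
  them, with entries \<open>xs m (T (x k))\<close>, is nearly diagonal with a large diagonal. A diagonal
  operator \<open>D\<close> with those diagonal entries factors the identity by hypothesis, and \<open>D\<close> is close to
  a compression \<open>B T A\<close> of \<open>T\<close>, so the identity factors through \<open>T\<close> as well.

  The blocks come from letting player (II) follow a winning strategy against a player (I) designed
  for \<open>T\<close> (\<open>winning_play_almost_biorthogonal\<close>). Player (I) splits the indices according to the sign
  of the diagonal entry of \<open>T\<close>, so that no cancellation occurs in
  \<open>\<Sum>i\<in>E. l i * u i * es i (T (e i))\<close>, where \<open>l\<close> and \<open>u\<close> are the nonnegative coefficients of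
  the blocks \<open>x k\<close> and \<open>xs k\<close> supported by \<open>E\<close>. This sum is the average of \<open>xs k (T (x k))\<close> over all signs, hence
  some choice of signs keeps \<open>xs k (T (x k))\<close> at least as large in modulus. The subspaces that
  player (I) proposes are annihilators of what was played before, which makes the off-diagonal
  entries as small as desired.

  Impartial equivalence with constant \<open>C + \<eta>\<close> gives an operator \<open>A\<close> with \<open>A (e k) = x k\<close> and
  \<open>norm A \<le> sqrt (C + \<eta>)\<close> (\<open>synthesis_operator\<close>), and, by duality, an operator
  \<open>B z = (\<Sum>k. xs k z * e k)\<close> with \<open>norm B \<le> \<lambda> * sqrt (C + \<eta>)\<close>, where \<open>\<lambda>\<close> is the basis constant
  (\<open>analysis_operator\<close>). The factor \<open>\<lambda>\<close> appears because the norm of a vector in the span of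
  finitely many basis vectors is computed by a functional on that span, which becomes a combination
  of biorthogonal functionals only after composition with a partial sum projection. Finitely many
  one-dimensional Hahn-Banach extensions produce this functional
  (\<open>norming_functional_on_finite_span\<close>).

  The matrix of \<open>B T A\<close> minus its diagonal has summable entries, so it defines a bounded operator of
  small norm; in particular the diagonal part \<open>D\<close> of \<open>B T A\<close> is itself bounded
  (\<open>almost_diagonal_compression\<close>). If \<open>S D R\<close> is the identity, then \<open>S B T A R\<close> is close to the
  identity, and a Neumann series removes the error (\<open>id_factors_through_near_compression\<close>). Letting
  \<open>\<eta>\<close> tend to zero gives the constant.
\<close>

section \<open>Bounded operators on Banach spaces\<close>

text \<open>
  By Baire's theorem one of the closed sets on which all \<open>Q n\<close> are bounded by \<open>m\<close> contains a ball;
  translating the ball to the origin costs a factor 2.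
\<close>
lemma uniform_boundedness:
  fixes Q :: "nat \<Rightarrow> 'a::banach \<Rightarrow>\<^sub>L 'b::real_normed_vector"
  assumes pw: "\<And>x. \<exists>c. \<forall>n. norm (Q n x) \<le> c"
  obtains M where "\<And>n. norm (Q n) \<le> M"
proof -
  define F where "F m = {x. \<forall>n. norm (Q n x) \<le> real m}" for m
  have F_closed: "closed (F m)" for m
    unfolding F_def by (intro closed_Collect_all closed_Collect_le continuous_intros)
  have F_cover: "(\<Union>m. F m) = UNIV"
  proof -
    have "\<exists>m. x \<in> F m" for x
    proof -
      obtain c where c: "\<And>n. norm (Q n x) \<le> c" using pw by blast
      obtain m :: nat where "c \<le> real m" using real_arch_simple by blast
      then have "x \<in> F m" unfolding F_def using c by (auto intro: order_trans)
      then show ?thesis by blast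
    qed
    then show ?thesis by blast
  qed
  have "\<exists>m. interior (F m) \<noteq> {}"
  proof (rule ccontr)
    assume "\<not> ?thesis"
    then have "Met_TC.mtopology interior_of \<Union>(range F) = {}"
      using F_closed
      by (intro Met_TC.metric_Baire_category_alt) (auto simp: complete_UNIV)
    then show False using F_cover by simp
  qed
  then obtain m x0 where "x0 \<in> interior (F m)" by blast
  then obtain r where r: "r > 0" "ball x0 r \<subseteq> F m"
    by (meson mem_interior)
  have small: "norm (Q n z) \<le> 2 * real m" if "norm z < r" for n z
  proof -
    have "x0 + z \<in> F m" "x0 \<in> F m" using r that by (auto simp: dist_norm subset_iff)
    then have "norm (Q n (x0 + z)) \<le> real m" "norm (Q n x0) \<le> real m" unfolding F_def by auto
    moreover have "Q n z = Q n (x0 + z) - Q n x0" by (simp add: blinfun.bilinear_simps)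
    ultimately show ?thesis using norm_triangle_ineq4[of "Q n (x0 + z)" "Q n x0"] by simp
  qed
  have "norm (Q n) \<le> 4 * real m / r" for n
  proof (rule norm_blinfun_bound)
    fix x
    show "norm (Q n x) \<le> 4 * real m / r * norm x"
    proof (cases "x = 0")
      case False
      define t where "t = r / (2 * norm x)"
      have t: "t > 0" "norm (t *\<^sub>R x) < r" using r False by (auto simp: t_def)
      have "t * norm (Q n x) = norm (Q n (t *\<^sub>R x))" using t by (simp add: blinfun.bilinear_simps)
      also have "\<dots> \<le> 2 * real m" using small t by blast
      finally have "norm (Q n x) \<le> 2 * real m / t" using t by (simp add: field_simps)
      also have "\<dots> = 4 * real m / r * norm x" using r False by (simp add: t_def)
      finally show ?thesis .
    qed simp
  qed (use r in auto)
  then show ?thesis using that by blast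
qed

text \<open>
  The left inverse is the Neumann series \<open>\<Sum>n. (id - Q)^n\<close>. Its powers are built by recursion on
  composition, which telescopes against \<open>Q\<close>.
\<close>
lemma left_inverse_near_id_blinfun:
  fixes Q :: "'a::banach \<Rightarrow>\<^sub>L 'a"
  assumes near: "norm (id_blinfun - Q) \<le> q" and q: "q < 1"
  obtains Q' where "Q' o\<^sub>L Q = id_blinfun" "norm Q' \<le> 1 / (1 - q)"
proof -
  define E where "E = id_blinfun - Q"
  define P where "P = rec_nat id_blinfun (\<lambda>_ X. X o\<^sub>L E)"
  have P0: "P 0 = id_blinfun" and PS: "P (Suc n) = P n o\<^sub>L E" for n by (simp_all add: P_def)
  have q0: "q \<ge> 0" using near norm_ge_zero order_trans by blast
  have nP: "norm (P n) \<le> q ^ n" for n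
  proof (induction n)
    case 0
    then show ?case by (simp add: P0 norm_blinfun_id_le)
  next
    case (Suc n)
    have "norm (P (Suc n)) \<le> norm (P n) * norm E" unfolding PS by (rule norm_blinfun_compose)
    also have "\<dots> \<le> q ^ n * q" using Suc near q0 by (intro mult_mono) (auto simp: E_def)
    finally show ?case by (simp add: mult.commute)
  qed
  have geo: "(\<lambda>n. q ^ n) sums (1 / (1 - q))" using geometric_sums[of q] q q0 by simp
  have sP: "summable P" using nP geo by (intro summable_comparison_test'[of "\<lambda>n. q ^ n" 0 P]) (auto simp: sums_iff)
  have bound: "norm (suminf P) \<le> 1 / (1 - q)"
  proof -
    have s: "summable (\<lambda>n. norm (P n))"
      using nP geo by (intro summable_comparison_test'[of "\<lambda>n. q ^ n" 0 "\<lambda>n. norm (P n)"]) (auto simp: sums_iff)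
    have "norm (suminf P) \<le> (\<Sum>n. norm (P n))" by (rule summable_norm[OF s])
    also have "\<dots> \<le> (\<Sum>n. q ^ n)" using nP geo s by (intro suminf_le) (auto simp: sums_iff)
    finally show ?thesis using geo by (simp add: sums_iff)
  qed
  have "(\<lambda>n. P n o\<^sub>L Q) sums (suminf P o\<^sub>L Q)"
    using bounded_linear.sums[OF bounded_bilinear.bounded_linear_left[OF bounded_bilinear_blinfun_compose]]
      summable_sums[OF sP] by blast
  moreover have "P n o\<^sub>L Q = P n - P (Suc n)" for n
    by (rule blinfun_eqI) (simp add: PS E_def blinfun.bilinear_simps)
  moreover have "(\<lambda>n. P n - P (Suc n)) sums (P 0 - 0)"
    using telescope_sums'[OF summable_LIMSEQ_zero[OF sP]] .
  ultimately have "suminf P o\<^sub>L Q = id_blinfun" using sums_unique2 P0 by fastforce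
  then show ?thesis using that bound by blast
qed

section \<open>Norming functionals on finite-dimensional subspaces\<close>

text \<open>
  The one-dimensional step of the Hahn-Banach theorem: the value \<open>c\<close> at \<open>v\<close> has to satisfy
  \<open>f x - norm (x - v) \<le> c \<le> norm (y + v) - f y\<close> for all \<open>x\<close> and \<open>y\<close> in the span, and the triangle
  inequality makes these two families of bounds compatible.
\<close>
lemma extend_dominated_functional:
  fixes f :: "'a::real_normed_vector \<Rightarrow> real"
  assumes f: "linear f" and dom: "\<And>x. x \<in> span S \<Longrightarrow> f x \<le> norm x"
  obtains g where "linear g" "\<And>x. x \<in> span S \<Longrightarrow> g x = f x"
    "\<And>x. x \<in> span (insert v S) \<Longrightarrow> g x \<le> norm x"
proof (cases "v \<in> span S")
  case True
  then show ?thesis using that[of f] f dom by (simp add: span_redundant)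
next
  case False
  define c where "c = (SUP x\<in>span S. f x - norm (x - v))"
  have key: "f x - norm (x - v) \<le> norm (y + v) - f y" if "x \<in> span S" "y \<in> span S" for x y
  proof -
    have "f x + f y = f (x + y)" by (simp add: linear_add[OF f])
    also have "\<dots> \<le> norm ((x - v) + (y + v))" using dom[OF span_add[OF that]] by simp
    also have "\<dots> \<le> norm (x - v) + norm (y + v)" by (rule norm_triangle_ineq)
    finally show ?thesis by simp
  qed
  have bdd: "bdd_above ((\<lambda>x. f x - norm (x - v)) ` span S)"
    by (rule bdd_aboveI2[of _ _ "norm (0 + v) - f 0"]) (use key span_zero in blast)
  have c1: "f x - c \<le> norm (x - v)" if "x \<in> span S" for x
    using cSUP_upper[OF that bdd] by (simp add: c_def)
  have c2: "f y + c \<le> norm (y + v)" if "y \<in> span S" for y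
  proof -
    have "c \<le> norm (y + v) - f y" unfolding c_def
      by (rule cSUP_least) (use key that span_zero in blast)+
    then show ?thesis by simp
  qed
  obtain B where B: "B \<subseteq> S" "independent B" "S \<subseteq> span B"
    using maximal_independent_subset[of S] by blast
  have sB: "span B = span S" using B by (metis span_mono span_span subset_antisym)
  have "independent (insert v B)" using B False sB independent_insertI by metis
  then obtain h :: "'a \<Rightarrow> real" where h: "linear h" "\<forall>x\<in>insert v B. h x = (if x = v then 1 else 0)"
    using linear_independent_extend[of "insert v B" "\<lambda>x. if x = v then 1 else 0"] by metis
  have "h x = 0" if "x \<in> B" for x using h that False sB span_base by fastforce
  then have h0: "h x = 0" if "x \<in> span S" for x
    using linear_eq_0_on_span[OF h(1), of B x] that sB by blast
  have hv: "h v = 1" using h by simp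
  \<comment> \<open>The functional \<open>h\<close> vanishes on \<open>span S\<close> and is 1 at \<open>v\<close>, so \<open>g v = c\<close>.\<close>
  define g where "g x = f x + (c - f v) * h x" for x
  have g: "linear g" unfolding g_def
    by (intro linear_compose_add f linear_compose_scale_right[of h, simplified] h)
  have "g w \<le> norm w" if "w \<in> span (insert v S)" for w
  proof -
    obtain k where k: "w - k *\<^sub>R v \<in> span S" using \<open>w \<in> span (insert v S)\<close> span_breakdown_eq by blast
    define u where "u = w - k *\<^sub>R v"
    have w: "w = u + k *\<^sub>R v" and u: "u \<in> span S" using k by (auto simp: u_def)
    have gw: "g w = f u + k * c"
      using h0[OF u] hv by (simp add: g_def w linear_add[OF f] linear_add[OF h(1)] linear_scale[OF f]
          linear_scale[OF h(1)] algebra_simps)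
    consider "k = 0" | "k > 0" | "k < 0" by linarith
    then show ?thesis
    proof cases
      case 1
      then show ?thesis using gw dom u w by simp
    next
      case 2
      have "f u + k * c = k * (f ((1/k) *\<^sub>R u) + c)" using 2 by (simp add: linear_scale[OF f] field_simps)
      also have "\<dots> \<le> k * norm ((1/k) *\<^sub>R u + v)" using 2 c2[OF span_scale[OF u]] by simp
      also have "\<dots> = norm (k *\<^sub>R ((1/k) *\<^sub>R u + v))" using 2 by simp
      also have "k *\<^sub>R ((1/k) *\<^sub>R u + v) = w" using 2 by (simp add: w scaleR_add_right)
      finally show ?thesis using gw by simp
    next
      case 3
      have "f u + k * c = (-k) * (f ((-1/k) *\<^sub>R u) - c)"
        unfolding linear_scale[OF f] using 3 by (simp add: field_simps)
      also have "\<dots> \<le> (-k) * norm ((-1/k) *\<^sub>R u - v)" by (intro mult_left_mono c1 span_scale u) (use 3 in auto)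
      also have "\<dots> = norm ((-k) *\<^sub>R ((-1/k) *\<^sub>R u - v))" using 3 by simp
      also have "(-k) *\<^sub>R ((-1/k) *\<^sub>R u - v) = w" using 3 by (simp add: w scaleR_diff_right)
      finally show ?thesis using gw by simp
    qed
  qed
  then show ?thesis using that[of g] g h0 by (simp add: g_def)
qed

text \<open>
  Only the restriction of \<open>f\<close> to the span is dominated by the norm; \<open>f\<close> need not be continuous on
  the whole space. This suffices below, where \<open>f\<close> is always composed with a projection onto the
  span.
\<close>
lemma norming_functional_on_finite_span:
  fixes y :: "'a::real_normed_vector"
  assumes "finite S"
  obtains f where "linear f" "f y = norm y" "\<And>x. x \<in> span S \<Longrightarrow> \<bar>f x\<bar> \<le> norm x"
proof -
  have "\<exists>f. linear f \<and> f y = norm y \<and> (\<forall>x\<in>span (insert y S). f x \<le> norm x)"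
    using assms
  proof (induction S rule: finite_induct)
    case empty
    show ?case
    proof (cases "y = 0")
      case True
      have "linear (\<lambda>x::'a. 0::real)" by (rule linear_zero)
      then show ?thesis using True by auto
    next
      case False
      then obtain f :: "'a \<Rightarrow> real" where f: "linear f" "f y = norm y"
        using linear_independent_extend[of "{y}" norm] by auto
      have "f x \<le> norm x" if x: "x \<in> span {y}" for x
      proof -
        obtain k where "x = k *\<^sub>R y" using x by (auto simp: span_singleton)
        then show ?thesis using f by (simp add: linear_scale mult_right_mono)
      qed
      then show ?thesis using f by blast
    qed
  next
    case (insert v S)
    then obtain f where f: "linear f" "f y = norm y" "\<And>x. x \<in> span (insert y S) \<Longrightarrow> f x \<le> norm x"
      by blast
    obtain g where "linear g" "\<And>x. x \<in> span (insert y S) \<Longrightarrow> g x = f x"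
      "\<And>x. x \<in> span (insert v (insert y S)) \<Longrightarrow> g x \<le> norm x"
      using extend_dominated_functional[OF f(1), of "insert y S" v] f(3) by metis
    then show ?case using f(2) by (metis insertI1 insert_commute span_base)
  qed
  then obtain f where f: "linear f" "f y = norm y" "\<And>x. x \<in> span (insert y S) \<Longrightarrow> f x \<le> norm x"
    by blast
  have "\<bar>f x\<bar> \<le> norm x" if "x \<in> span S" for x
  proof -
    have "x \<in> span (insert y S)" using that span_mono[of S "insert y S"] by blast
    then show ?thesis using f(3)[of x] f(3)[of "- x"] span_neg[of x] linear_neg[OF f(1), of x] by auto
  qed
  then show ?thesis using f that by blast
qed

section \<open>Choosing signs\<close>

text \<open>
  The trace is the average of the quadratic form over all signs. The signs can be found greedily:
  a new index contributes its diagonal entry plus \<open>t * c\<close>, where \<open>t\<close> is the new sign and \<open>c\<close> is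
  fixed by the earlier ones.
\<close>
lemma exists_signs_quadratic_form_ge_trace:
  fixes a :: "'i \<Rightarrow> 'i \<Rightarrow> real"
  assumes "finite E"
  shows "\<exists>s \<in> E \<rightarrow>\<^sub>E {-1, 1}. (\<Sum>i\<in>E. a i i) \<le> (\<Sum>i\<in>E. \<Sum>j\<in>E. s i * s j * a i j)"
  using assms
proof (induction E rule: finite_induct)
  case (insert p E)
  then obtain s where s: "s \<in> E \<rightarrow>\<^sub>E {-1, 1}"
    "(\<Sum>i\<in>E. a i i) \<le> (\<Sum>i\<in>E. \<Sum>j\<in>E. s i * s j * a i j)" by blast
  define c where "c = (\<Sum>j\<in>E. s j * (a p j + a j p))"
  define t :: real where "t = (if c \<ge> 0 then 1 else -1)"
  define s' where "s' = s(p := t)"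
  have t: "t * t = 1" "t * c \<ge> 0" "t \<in> {-1, 1}" by (auto simp: t_def)
  have s': "s' \<in> insert p E \<rightarrow>\<^sub>E {-1, 1}"
    unfolding s'_def using s(1) t(3) by (rule PiE_fun_upd[rotated])
  have s'E: "s' i = s i" if "i \<in> E" for i using that insert by (auto simp: s'_def)
  have s'p: "s' p = t" by (simp add: s'_def)
  have "(\<Sum>i\<in>insert p E. \<Sum>j\<in>insert p E. s' i * s' j * a i j)
      = a p p + t * c + (\<Sum>i\<in>E. \<Sum>j\<in>E. s i * s j * a i j)"
    using insert t(1)
    by (simp add: s'E s'p c_def sum.distrib sum_distrib_left algebra_simps)
  then show ?case using s(2) t(2) insert s' by (intro bexI[of _ s']) auto
qed auto

lemma exists_signs_quadratic_form_abs_ge_trace: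
  fixes a :: "'i \<Rightarrow> 'i \<Rightarrow> real"
  assumes "finite E"
  shows "\<exists>s \<in> E \<rightarrow>\<^sub>E {-1, 1}. \<bar>\<Sum>i\<in>E. a i i\<bar> \<le> \<bar>\<Sum>i\<in>E. \<Sum>j\<in>E. s i * s j * a i j\<bar>"
proof (cases "(\<Sum>i\<in>E. a i i) \<ge> 0")
  case True
  obtain s where "s \<in> E \<rightarrow>\<^sub>E {-1, 1}"
    "(\<Sum>i\<in>E. a i i) \<le> (\<Sum>i\<in>E. \<Sum>j\<in>E. s i * s j * a i j)"
    using exists_signs_quadratic_form_ge_trace[OF assms, of a] by blast
  then show ?thesis using True by (intro bexI[of _ s]) linarith+
next
  case False
  obtain s where "s \<in> E \<rightarrow>\<^sub>E {-1, 1}"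
    "(\<Sum>i\<in>E. - a i i) \<le> (\<Sum>i\<in>E. \<Sum>j\<in>E. s i * s j * - a i j)"
    using exists_signs_quadratic_form_ge_trace[OF assms, of "\<lambda>i j. - a i j"] by blast
  then show ?thesis using False by (intro bexI[of _ s]) (simp_all add: sum_negf)
qed

section \<open>Annihilators of finite sets\<close>

text \<open>
  Intersecting with one more kernel raises the codimension by at most one: if \<open>f\<close> is nonzero at some
  \<open>v\<close> of the earlier intersection, then \<open>v\<close> together with the new one spans the earlier one.
\<close>
lemma finite_codim_subspace_kernels:
  fixes F :: "('a::real_vector \<Rightarrow> real) set"
  assumes "finite F" and "\<And>f. f \<in> F \<Longrightarrow> linear f"
  shows "finite_codim_subspace {x. \<forall>f\<in>F. f x = 0}"
  using assms
proof (induction F rule: finite_induct)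
  case empty
  have "subspace (UNIV :: 'a set)" by simp
  then show ?case unfolding finite_codim_subspace_def by (auto intro!: exI[of _ "{}"])
next
  case (insert f F)
  let ?V = "{x. \<forall>f\<in>F. f x = 0}" and ?V' = "{x. \<forall>f\<in>insert f F. f x = 0}"
  have lin: "linear g" if "g \<in> insert f F" for g using insert.prems that by blast
  have sub: "subspace ?V'"
    unfolding subspace_def using lin by (auto simp: linear_add linear_scale linear_0)
  obtain B where B: "finite B" "span (?V \<union> B) = UNIV"
    using insert unfolding finite_codim_subspace_def by blast
  show ?case
  proof (cases "\<exists>v\<in>?V. f v \<noteq> 0")
    case False
    then have "?V' = ?V" by auto
    then have "span (?V' \<union> B) = UNIV" using B(2) by simp
    then show ?thesis using B(1) sub unfolding finite_codim_subspace_def by (intro conjI exI[of _ B])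
  next
    case True
    then obtain v where v: "v \<in> ?V" "f v \<noteq> 0" by blast
    have "x \<in> span (?V' \<union> insert v B)" if x: "x \<in> ?V" for x
    proof -
      let ?c = "f x / f v"
      have "x - ?c *\<^sub>R v \<in> ?V'"
        using x v lin by (auto simp: linear_diff linear_scale)
      then have "(x - ?c *\<^sub>R v) + ?c *\<^sub>R v \<in> span (?V' \<union> insert v B)"
        by (intro span_add span_scale) (auto intro: span_base)
      then show ?thesis by simp
    qed
    then have "?V \<union> B \<subseteq> span (?V' \<union> insert v B)" by (auto intro: span_base)
    then have "span (?V' \<union> insert v B) = UNIV"
      using B(2) span_minimal[OF _ subspace_span] by blast
    then show ?thesis using B(1) sub unfolding finite_codim_subspace_def
      by (intro conjI exI[of _ "insert v B"]) auto
  qed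
qed

lemma kernels_in_cof:
  fixes F :: "('a::real_normed_vector \<Rightarrow>\<^sub>L real) set"
  assumes "finite F"
  shows "{x. \<forall>f\<in>F. f x = 0} \<in> cof"
proof -
  have "finite_codim_subspace {x. \<forall>f\<in>blinfun_apply ` F. f x = 0}"
    by (rule finite_codim_subspace_kernels) (use assms in \<open>auto intro: bounded_linear.linear blinfun.bounded_linear_right\<close>)
  moreover have "{x. \<forall>f\<in>F. blinfun_apply f x = 0} = (\<Inter>f\<in>F. {x. blinfun_apply f x = 0})" by auto
  then have "closed {x. \<forall>f\<in>F. f x = 0}"
    by (auto intro!: closed_INT closed_Collect_eq continuous_intros)
  ultimately show ?thesis unfolding cof_def by simp
qed

lemma annihilator_in_cof_wstar:
  fixes F :: "'a::real_normed_vector set"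
  assumes "finite F"
  shows "{f :: 'a \<Rightarrow>\<^sub>L real. \<forall>v\<in>F. f v = 0} \<in> cof_wstar"
proof -
  have "finite_codim_subspace {f :: 'a \<Rightarrow>\<^sub>L real. \<forall>g\<in>(\<lambda>v f. blinfun_apply f v) ` F. g f = 0}"
    by (rule finite_codim_subspace_kernels) (use assms in \<open>auto intro: bounded_linear.linear blinfun.bounded_linear_left\<close>)
  moreover have "closedin strong_operator_topology {f :: 'a \<Rightarrow>\<^sub>L real. \<forall>v\<in>F. f v = 0}"
  proof -
    have "closedin strong_operator_topology {f :: 'a \<Rightarrow>\<^sub>L real. f v = 0}" for v
      using closedin_continuous_map_preimage[OF strong_operator_topology_continuous_evaluation[of v],
          of "{0::real}"]
      by (simp add: strong_operator_topology_topspace)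
    then have "closedin strong_operator_topology
        (topspace strong_operator_topology \<inter> (\<Inter>v\<in>F. {f :: 'a \<Rightarrow>\<^sub>L real. f v = 0}))"
      by (cases "F = {}") auto
    moreover have "topspace strong_operator_topology \<inter> (\<Inter>v\<in>F. {f :: 'a \<Rightarrow>\<^sub>L real. f v = 0})
        = {f. \<forall>v\<in>F. blinfun_apply f v = 0}" by (auto simp: strong_operator_topology_topspace)
    ultimately show ?thesis by simp
  qed
  ultimately show ?thesis unfolding cof_wstar_def by simp
qed

lemma infdist_less_obtains:
  assumes "infdist x A < t" and "A \<noteq> {}"
  obtains a where "a \<in> A" "dist x a < t"
proof -
  have "(INF a\<in>A. dist x a) < t" using assms by (simp add: infdist_notempty)
  then show ?thesis using cInf_lessD[of "dist x ` A" t] assms(2) that by auto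
qed

lemma apply_near_kernels:
  fixes f :: "'a::real_normed_vector \<Rightarrow>\<^sub>L real"
  assumes "infdist x {x. \<forall>f\<in>F. blinfun_apply f x = 0} < t" and "f \<in> F"
  shows "\<bar>f x\<bar> \<le> t * norm f"
proof -
  have "0 \<in> {x. \<forall>f\<in>F. blinfun_apply f x = 0}" by simp
  then have "{x. \<forall>f\<in>F. blinfun_apply f x = 0} \<noteq> {}" unfolding ex_in_conv[symmetric] by (rule exI)
  then obtain w where "w \<in> {x. \<forall>f\<in>F. blinfun_apply f x = 0}" "dist x w < t"
    by (rule infdist_less_obtains[OF assms(1)])
  then have w: "\<forall>f\<in>F. blinfun_apply f w = 0" "dist x w < t" by simp_all
  have "\<bar>f x\<bar> = norm (f (x - w))" using w assms(2) by (simp add: blinfun.diff_right)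
  also have "\<dots> \<le> norm f * norm (x - w)" by (rule norm_blinfun)
  also have "\<dots> \<le> norm f * t" using w by (intro mult_left_mono) (auto simp: dist_norm)
  finally show ?thesis by (simp add: mult.commute)
qed

lemma apply_near_annihilator:
  fixes f :: "'a::real_normed_vector \<Rightarrow>\<^sub>L real"
  assumes "infdist f {f. \<forall>v\<in>F. blinfun_apply f v = 0} < t" and "v \<in> F"
  shows "\<bar>f v\<bar> \<le> t * norm v"
proof -
  have "0 \<in> {f. \<forall>v\<in>F. blinfun_apply f v = 0}" by simp
  then have "{f. \<forall>v\<in>F. blinfun_apply f v = 0} \<noteq> {}" unfolding ex_in_conv[symmetric] by (rule exI)
  then obtain g where "g \<in> {f. \<forall>v\<in>F. blinfun_apply f v = 0}" "dist f g < t"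
    by (rule infdist_less_obtains[OF assms(1)])
  then have g: "\<forall>v\<in>F. blinfun_apply g v = 0" "dist f g < t" by simp_all
  have "\<bar>f v\<bar> = norm ((f - g) v)" using g assms(2) by (simp add: blinfun.diff_left)
  also have "\<dots> \<le> norm (f - g) * norm v" by (rule norm_blinfun)
  also have "\<dots> \<le> t * norm v" using g by (intro mult_right_mono) (auto simp: dist_norm)
  finally show ?thesis .
qed

section \<open>Playing against a winning strategy\<close>

text \<open>
  When player (I) plays by fixed rules, \<open>p1\<close> for the first step (depending on the past turns) and
  \<open>p3\<close> for the signs (depending on the answer of player (II)), the strategy \<open>\<sigma>\<close> determines the
  whole play. It is built as a growing history.
\<close>
lemma play_against_strategy:
  fixes \<sigma> :: "'a::real_normed_vector strategy"
  obtains play :: "nat \<Rightarrow> 'a turn" where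
    "\<And>k. play k =
      (let h = map play [0..<k]; m = p1 h; r = \<sigma> N h m in (m, r, p3 r))"
proof -
  define nxt where "nxt h = (let m = p1 h; r = \<sigma> N h m in (m, r, p3 r))" for h
  define hist where "hist = rec_nat [] (\<lambda>_ h. h @ [nxt h])"
  have hist: "hist 0 = []" "hist (Suc k) = hist k @ [nxt (hist k)]" for k
    by (simp_all add: hist_def)
  have "map (\<lambda>k. nxt (hist k)) [0..<k] = hist k" for k
    by (induction k) (simp_all add: hist)
  then show ?thesis by (intro that[of "\<lambda>k. nxt (hist k)"]) (simp add: nxt_def Let_def)
qed

text \<open>
  The rules of player (I) for a given operator \<open>T\<close>: split the indices by the sign of
  \<open>es n (T (e n))\<close>; demand that \<open>x k\<close> be almost annihilated by all earlier \<open>xs j o T\<close>, and that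
  \<open>xs k\<close> almost annihilate all earlier \<open>T (x j)\<close> and \<open>e j\<close>; choose the signs such that
  \<open>xs k (T (x k))\<close> dominates the sum of the diagonal terms. The last conclusion is what makes the
  series defining the analysis operator converge on the basis vectors.
\<close>
lemma winning_play_almost_biorthogonal:
  fixes e :: "nat \<Rightarrow> 'a::real_normed_vector" and T :: "'a \<Rightarrow>\<^sub>L 'a"
  assumes win: "winning_strategy e es C \<eta> \<sigma>"
    and diag: "\<And>n. \<delta> \<le> \<bar>es n (T (e n))\<bar>" and \<delta>: "\<delta> \<ge> 0"
    and tol: "\<And>k. tol k > 0"
  obtains x :: "nat \<Rightarrow> 'a" and xs :: "nat \<Rightarrow> 'a \<Rightarrow>\<^sub>L real" where
    "impartially_equivalent (C + \<eta>) x e"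
    "impartially_equivalent (C + \<eta>) xs es"
    "\<And>k. \<delta> * (1 - \<eta>) \<le> \<bar>xs k (T (x k))\<bar>"
    "\<And>j k. j < k \<Longrightarrow> \<bar>xs j (T (x k))\<bar> \<le> tol k * norm (xs j o\<^sub>L T)"
    "\<And>j k. j < k \<Longrightarrow> \<bar>xs k (T (x j))\<bar> \<le> tol k * norm (T (x j))"
    "\<And>j k. j < k \<Longrightarrow> \<bar>xs k (e j)\<bar> \<le> tol k * norm (e j)"
proof -
  define N1 where "N1 = {n. \<delta> \<le> es n (T (e n))}"
  define N2 where "N2 = - N1"
  define vec :: "'a turn \<Rightarrow> 'a" where
    "vec = (\<lambda>(m, (i, E, l, u), s). block_vector e E l s)"
  define fnl :: "'a turn \<Rightarrow> 'a \<Rightarrow>\<^sub>L real" where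
    "fnl = (\<lambda>(m, (i, E, l, u), s). block_vector es E u s)"
  define Wset where "Wset h = {x. \<forall>f\<in>(\<lambda>t. fnl t o\<^sub>L T) ` set h. blinfun_apply f x = 0}" for h
  define Gset :: "'a turn list \<Rightarrow> ('a \<Rightarrow>\<^sub>L real) set" where 
    "Gset h = {f. \<forall>v\<in>(\<lambda>t. T (vec t)) ` set h \<union> e ` {..<length h}. blinfun_apply f v = 0}"
    for h
  \<comment> \<open>With signs \<open>s\<close>, the value \<open>xs k (T (x k))\<close> is the quadratic form of the matrix \<open>q\<close> at \<open>s\<close>.\<close>
  define q where "q l u i j = u i * l j * es i (T (e j))" for l u i j
  define good where "good E l u s \<longleftrightarrow> s \<in> E \<rightarrow>\<^sub>E {-1, 1} \<and>
      (finite E \<longrightarrow> \<bar>\<Sum>i\<in>E. q l u i i\<bar> \<le> \<bar>\<Sum>i\<in>E. \<Sum>j\<in>E. s i * s j * q l u i j\<bar>)"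
    for E l u and s :: step3
  define p3 where "p3 = (\<lambda>(i::nat, E, l, u). SOME s. good E l u s)"
  \<comment> \<open>The rules must yield legal signs for every answer, so infinite \<open>E\<close> is covered too.\<close>
  have good: "good E l u (p3 (i, E, l, u))" for i E l u
  proof -
    have "\<exists>s. good E l u s"
    proof (cases "finite E")
      case True
      then show ?thesis using exists_signs_quadratic_form_abs_ge_trace[OF True, of "q l u"]
        unfolding good_def by blast
    next
      case False
      have "(\<lambda>i\<in>E. 1) \<in> E \<rightarrow>\<^sub>E {-1, 1::real}" by auto
      then show ?thesis using False unfolding good_def by blast
    qed
    then show ?thesis unfolding p3_def by (simp add: someI_ex)
  qed
  obtain play :: "nat \<Rightarrow> 'a turn" where play: "\<And>k. play k =
      (let h = map play [0..<k]; m = (tol (length h), Wset h, Gset h);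
           r = \<sigma> (N1, N2) h m in (m, r, p3 r))"
    using play_against_strategy[of "\<lambda>h. (tol (length h), Wset h, Gset h)" \<sigma> "(N1, N2)" p3] by blast
  define side E lam mu sgns where
    "side k = fst (fst (snd (play k)))" and "E k = fst (snd (fst (snd (play k))))"
    and "lam k = fst (snd (snd (fst (snd (play k)))))"
    and "mu k = snd (snd (snd (fst (snd (play k)))))" and "sgns k = snd (snd (play k))" for k
  define W G where "W k = Wset (map play [0..<k])" and "G k = Gset (map play [0..<k])" for k
  have m: "fst (play k) = (tol k, W k, G k)" for k
    by (subst play) (simp add: Let_def W_def G_def)
  have r: "fst (snd (play k)) = \<sigma> (N1, N2) (map play [0..<k]) (tol k, W k, G k)" for k
    by (subst play) (simp add: Let_def W_def G_def)
  have s: "snd (snd (play k)) = p3 (fst (snd (play k)))" for k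
    by (subst (1 2) play) (simp add: Let_def)
  have turn: "play k = ((tol k, W k, G k), (side k, E k, lam k, mu k), sgns k)" for k
    by (simp add: side_def E_def lam_def mu_def sgns_def flip: m)
  have hist: "map (\<lambda>j. ((tol j, W j, G j), (side j, E j, lam j, mu j), sgns j)) [0..<k] = map play [0..<k]"
    for k by (simp flip: turn)
  have sg: "good (E k) (lam k) (mu k) (sgns k)" for k
    using good[of "E k" "lam k" "mu k" "side k"] s[of k]
    by (simp add: side_def E_def lam_def mu_def sgns_def)
  define x where "x k = block_vector e (E k) (lam k) (sgns k)" for k
  define xs where "xs k = block_vector es (E k) (mu k) (sgns k)" for k
  have vec: "vec (play k) = x k" and fnl: "fnl (play k) = xs k" for k
    by (simp_all add: turn vec_def fnl_def x_def xs_def)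
  have legal: "W k \<in> cof" "G k \<in> cof_wstar" for k
    unfolding W_def Wset_def G_def Gset_def
    by (rule kernels_in_cof annihilator_in_cof_wstar; simp)+
  have "(\<forall>k. side k \<in> {1, 2} \<and> finite (E k) \<and> E k \<subseteq> (if side k = 1 then N1 else N2) \<and>
             (\<forall>i\<in>E k. lam k i \<ge> 0 \<and> mu k i \<ge> 0) \<and>
             1 - \<eta> < (\<Sum>i\<in>E k. lam k i * mu k i) \<and> (\<Sum>i\<in>E k. lam k i * mu k i) < 1 + \<eta>) \<and>
        impartially_equivalent (C + \<eta>) x e \<and> impartially_equivalent (C + \<eta>) xs es \<and>
        (\<forall>k. infdist (x k) (W k) < tol k) \<and> (\<forall>k. infdist (xs k) (G k) < tol k)"
    unfolding x_def xs_def
  proof (rule win[unfolded winning_strategy_def, rule_format], intro conjI allI)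
    show "(side k, E k, lam k, mu k) = \<sigma> (N1, N2)
               (map (\<lambda>j. ((tol j, W j, G j), (side j, E j, lam j, mu j), sgns j)) [0..<k])
               (tol k, W k, G k)" for k
      unfolding hist r[symmetric] by (simp add: turn)
    show "sgns k \<in> E k \<rightarrow>\<^sub>E {- 1, 1}" for k using sg unfolding good_def by blast
  qed (use tol legal in \<open>auto simp: N2_def\<close>)
  note won = this
  have fin: "finite (E k)" for k using won by blast
  have one_side: "E k \<subseteq> N1 \<or> E k \<subseteq> N2" for k
  proof -
    have "E k \<subseteq> (if side k = 1 then N1 else N2)" using won by blast
    then show ?thesis by (simp split: if_splits)
  qed
  have nonneg: "0 \<le> lam k i * mu k i" if "i \<in> E k" for k i
    using won that by (intro mult_nonneg_nonneg) blast+
  have total: "1 - \<eta> \<le> (\<Sum>i\<in>E k. lam k i * mu k i)" for k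
    using won less_imp_le by blast
  have equiv: "impartially_equivalent (C + \<eta>) x e" "impartially_equivalent (C + \<eta>) xs es"
    using won by blast+
  have near: "infdist (x k) (W k) < tol k" "infdist (xs k) (G k) < tol k" for k
    using won by blast+
  have "\<delta> * (1 - \<eta>) \<le> \<bar>xs k (T (x k))\<bar>" for k
  proof -
    have "\<delta> * (1 - \<eta>) \<le> (\<Sum>i\<in>E k. lam k i * mu k i * \<delta>)"
      using mult_left_mono[OF total[of k] \<delta>] by (simp add: sum_distrib_left mult.commute)
    also have "\<dots> \<le> \<bar>\<Sum>i\<in>E k. q (lam k) (mu k) i i\<bar>"
    proof (cases "E k \<subseteq> N1")
      case True
      then have "(\<Sum>i\<in>E k. lam k i * mu k i * \<delta>) \<le> (\<Sum>i\<in>E k. lam k i * mu k i * es i (T (e i)))"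
        using nonneg by (intro sum_mono mult_left_mono) (auto simp: N1_def)
      then show ?thesis by (simp add: q_def mult.commute)
    next
      case False
      have "\<delta> \<le> - es i (T (e i))" if "i \<in> E k" for i
        using False one_side[of k] that diag[of i] by (auto simp: N1_def N2_def)
      then have "(\<Sum>i\<in>E k. lam k i * mu k i * \<delta>) \<le> (\<Sum>i\<in>E k. lam k i * mu k i * - es i (T (e i)))"
        using nonneg by (intro sum_mono mult_left_mono) auto
      then show ?thesis by (simp add: q_def mult.commute sum_negf)
    qed
    also have "\<dots> \<le> \<bar>\<Sum>i\<in>E k. \<Sum>j\<in>E k. sgns k i * sgns k j * q (lam k) (mu k) i j\<bar>"
      using sg[of k] fin[of k] unfolding good_def by blast
    also have "(\<Sum>i\<in>E k. \<Sum>j\<in>E k. sgns k i * sgns k j * q (lam k) (mu k) i j) = xs k (T (x k))"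
      by (subst sum.swap) (simp add: xs_def x_def block_vector_def q_def blinfun.sum_left blinfun.sum_right
          blinfun.scaleR_left blinfun.scaleR_right sum_distrib_left mult_ac)
    finally show ?thesis .
  qed
  moreover have "\<bar>xs j (T (x k))\<bar> \<le> tol k * norm (xs j o\<^sub>L T)" if "j < k" for j k
  proof -
    have "xs j o\<^sub>L T \<in> (\<lambda>t. fnl t o\<^sub>L T) ` set (map play [0..<k])"
      unfolding fnl[symmetric] using that by (intro imageI) simp
    from apply_near_kernels[OF near(1)[of k, unfolded W_def Wset_def] this] show ?thesis by simp
  qed
  moreover have "\<bar>xs k v\<bar> \<le> tol k * norm v"
    if "v \<in> (\<lambda>t. T (vec t)) ` set (map play [0..<k]) \<union> e ` {..<k}" for k v
    using apply_near_annihilator[OF near(2)[of k, unfolded G_def Gset_def]] that by simp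
  moreover have "T (x j) \<in> (\<lambda>t. T (vec t)) ` set (map play [0..<k])" if "j < k" for j k
    unfolding vec[symmetric] using that by (intro imageI) simp
  ultimately show ?thesis using equiv by (intro that[of x xs]) auto
qed

section \<open>Operators prescribed on a Schauder basis\<close>

definition partial_sum_op ::
    "(nat \<Rightarrow> 'a::real_normed_vector \<Rightarrow>\<^sub>L real) \<Rightarrow> (nat \<Rightarrow> 'b::real_normed_vector) \<Rightarrow> nat \<Rightarrow> 'a \<Rightarrow>\<^sub>L 'b"
  where "partial_sum_op f v n = (\<Sum>i<n. blinfun_scaleR_left (v i) o\<^sub>L f i)"

lemma partial_sum_op_apply: "partial_sum_op f v n x = (\<Sum>i<n. f i x *\<^sub>R v i)"
  by (simp add: partial_sum_op_def blinfun.sum_left)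

text \<open>
  The upper half of impartial equivalence, with initial segments in place of arbitrary finite
  supports.
\<close>
definition dominated_by ::
    "real \<Rightarrow> (nat \<Rightarrow> 'a::real_normed_vector) \<Rightarrow> (nat \<Rightarrow> 'b::real_normed_vector) \<Rightarrow> bool" where
  "dominated_by L x y \<longleftrightarrow>
     (\<forall>(a :: nat \<Rightarrow> real) n. norm (\<Sum>i<n. a i *\<^sub>R x i) \<le> L * norm (\<Sum>i<n. a i *\<^sub>R y i))"

lemma impartially_equivalent_imp_dominated_by:
  assumes "impartially_equivalent C x y"
  shows "dominated_by (sqrt C) x y"
  unfolding dominated_by_def
proof (intro allI)
  fix a :: "nat \<Rightarrow> real" and n
  define b where "b i = (if i < n then a i else 0)" for i
  have supp: "{i. b i \<noteq> 0} \<subseteq> {..<n}" by (auto simp: b_def)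
  then have fin: "finite {i. b i \<noteq> 0}" using finite_subset by blast
  have eq: "(\<Sum>i | b i \<noteq> 0. b i *\<^sub>R z i) = (\<Sum>i<n. a i *\<^sub>R z i)" for z :: "nat \<Rightarrow> 'c::real_vector"
    by (rule sum.mono_neutral_cong_left) (use supp in \<open>auto simp: b_def\<close>)
  have "norm (\<Sum>i | b i \<noteq> 0. b i *\<^sub>R x i) \<le> sqrt C * norm (\<Sum>i | b i \<noteq> 0. b i *\<^sub>R y i)"
    using assms fin unfolding impartially_equivalent_def by blast
  then show "norm (\<Sum>i<n. a i *\<^sub>R x i) \<le> sqrt C * norm (\<Sum>i<n. a i *\<^sub>R y i)"
    unfolding eq .
qed

lemma dominated_by_norm:
  assumes "dominated_by L x y"
  shows "norm (x k) \<le> L * norm (y k)"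
proof -
  have "(\<Sum>i<Suc k. (if i = k then 1 else 0::real) *\<^sub>R z i) = z k" for z :: "nat \<Rightarrow> 'c::real_vector"
    by (simp add: if_distrib[of "\<lambda>c. c *\<^sub>R _"] cong: if_cong)
  then show ?thesis
    using assms[unfolded dominated_by_def, rule_format, of "\<lambda>i. if i = k then 1 else 0" "Suc k"]
    by simp
qed

locale schauder_system =
  fixes e :: "nat \<Rightarrow> 'a::banach" and es :: "nat \<Rightarrow> 'a \<Rightarrow>\<^sub>L real"
  assumes basis: "schauder_basis e" and normal: "normalized e" and biorth: "biorthogonal e es"
begin

abbreviation "P \<equiv> partial_sum_op es e"
abbreviation "lam \<equiv> basis_constant e es"

lemma es_e: "es i (e j) = (if i = j then 1 else 0)"
  using biorth unfolding biorthogonal_def by blast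

lemma norm_e: "norm (e n) = 1"
  using normal unfolding normalized_def by blast

text \<open>
  Continuity of \<open>es i\<close> and biorthogonality force the coefficients of the expansion of \<open>x\<close>.
\<close>
lemma expansion: "(\<lambda>n. es n x *\<^sub>R e n) sums x"
proof -
  obtain a where a: "(\<lambda>n. a n *\<^sub>R e n) sums x"
    using basis unfolding schauder_basis_def by blast
  have "a i = es i x" for i
  proof -
    have "(\<lambda>n. es i (a n *\<^sub>R e n)) sums es i x"
      using bounded_linear.sums[OF blinfun.bounded_linear_right a] .
    moreover have "es i (a n *\<^sub>R e n) = (if n = i then a n else 0)" for n
      by (simp add: blinfun.scaleR_right es_e)
    ultimately have "(\<lambda>n. if n = i then a n else 0) sums es i x" by simp
    then show ?thesis using sums_single[of i a] sums_unique2 by blast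
  qed
  then show ?thesis using a by simp
qed

lemma P_tendsto: "(\<lambda>n. P n x) \<longlonglongrightarrow> x"
  using expansion[of x] unfolding sums_def partial_sum_op_apply .

text \<open>
  A real supremum bounds its members only if the set is bounded above. Here this is the
  Banach-Steinhaus theorem, as the partial sums of every \<open>x\<close> converge.
\<close>
lemma norm_P: "norm (P n) \<le> lam"
proof -
  have "\<exists>c. \<forall>n. norm (P n x) \<le> c" for x
    using convergent_imp_bounded[OF P_tendsto, of x] unfolding bounded_iff by auto
  then obtain M where M: "\<And>n. norm (P n) \<le> M" using uniform_boundedness[of P] by metis
  have eq: "onorm (\<lambda>x. \<Sum>i<n. es i x *\<^sub>R e i) = norm (P n)" for n
    by (simp add: norm_blinfun.rep_eq flip: partial_sum_op_apply)
  have "bdd_above (range (\<lambda>n. norm (P n)))" using M by (intro bdd_aboveI2[of _ _ M])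
  then show ?thesis unfolding basis_constant_def eq by (rule cSUP_upper[OF UNIV_I])
qed

lemma norm_P_apply: "norm (P n x) \<le> lam * norm x"
  by (rule order_trans[OF norm_blinfun mult_right_mono[OF norm_P norm_ge_zero]])

lemma basis_constant_ge_1: "lam \<ge> 1"
proof -
  have "P 1 (e 0) = e 0" by (simp add: partial_sum_op_apply es_e)
  then show ?thesis using norm_P_apply[of 1 "e 0"] by (simp add: norm_e)
qed

lemma norm_es: "norm (es n) \<le> 2 * lam"
proof (rule norm_blinfun_bound)
  fix x
  have "norm (es n x) = norm (P (Suc n) x - P n x)"
    by (simp add: partial_sum_op_apply norm_e)
  also have "\<dots> \<le> norm (P (Suc n) x) + norm (P n x)" by (rule norm_triangle_ineq4)
  also have "\<dots> \<le> 2 * lam * norm x" using norm_P_apply[of "Suc n" x] norm_P_apply[of n x] by simp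
  finally show "norm (es n x) \<le> 2 * lam * norm x" .
qed (use basis_constant_ge_1 in auto)

lemma partial_sum_op_e:
  assumes "k < n"
  shows "partial_sum_op es v n (e k) = v k"
  using assms by (simp add: partial_sum_op_apply es_e if_distrib[of "\<lambda>c. c *\<^sub>R _"] cong: if_cong)

lemma P_in_span: "P n x \<in> span (e ` {..<n})"
  unfolding partial_sum_op_apply by (intro span_sum span_scale span_base) auto

text \<open>
  Uniformly bounded operators that converge on the basis vectors converge on finite linear
  combinations and hence, by density, everywhere.
\<close>
lemma bounded_limit_operator:
  fixes Q :: "nat \<Rightarrow> 'a \<Rightarrow>\<^sub>L 'b::banach"
  assumes bound: "\<And>n x. norm (Q n x) \<le> M * norm x"
    and conv: "\<And>j. convergent (\<lambda>n. Q n (e j))"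
  obtains B where "\<And>x. (\<lambda>n. Q n x) \<longlonglongrightarrow> blinfun_apply B x"
proof -
  have M0: "M \<ge> 0" using order_trans[OF norm_ge_zero bound[of 0 "e 0"]] by (simp add: norm_e)
  have lim: "convergent (\<lambda>n. Q n x)" for x
  proof -
    have "Cauchy (\<lambda>n. Q n x)"
    proof (rule CauchyI)
      fix r :: real assume r: "r > 0"
      define s where "s = r / (3 * (M + 1))"
      have s: "s > 0" using r M0 by (simp add: s_def)
      obtain N where N: "norm (P N x - x) < s" using LIMSEQ_D[OF P_tendsto s] by blast
      define p where "p = P N x"
      have tail: "norm (Q n x - Q n p) < r / 3" for n
      proof -
        have "norm (Q n x - Q n p) \<le> M * norm (x - p)"
          using bound[of n "x - p"] by (simp add: blinfun.diff_right)
        also have "\<dots> \<le> M * s" using N M0 by (intro mult_left_mono) (auto simp: p_def norm_minus_commute)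
        also have "\<dots> < (M + 1) * s" using s by simp
        also have "\<dots> = r / 3" using M0 by (auto simp: s_def divide_simps algebra_simps)
        finally show ?thesis .
      qed
      obtain l where l: "\<And>j. (\<lambda>n. Q n (e j)) \<longlonglongrightarrow> l j"
        using conv unfolding convergent_def by metis
      have "(\<lambda>n. \<Sum>j<N. es j x *\<^sub>R Q n (e j)) \<longlonglongrightarrow> (\<Sum>j<N. es j x *\<^sub>R l j)"
        by (intro tendsto_intros l)
      then have "Cauchy (\<lambda>n. Q n p)"
        by (intro LIMSEQ_imp_Cauchy)
          (simp add: p_def partial_sum_op_apply blinfun.sum_right blinfun.scaleR_right)
      then obtain n0 where n0: "\<And>m n. m \<ge> n0 \<Longrightarrow> n \<ge> n0 \<Longrightarrow> norm (Q m p - Q n p) < r / 3"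
        using r CauchyD[of "\<lambda>n. Q n p" "r / 3"] by auto
      have "norm (Q m x - Q n x) < r" if "m \<ge> n0" "n \<ge> n0" for m n
      proof -
        have "norm (Q m x - Q n x) = norm ((Q m x - Q m p) + (Q m p - Q n p) - (Q n x - Q n p))"
          by simp
        also have "\<dots> \<le> norm (Q m x - Q m p) + norm (Q m p - Q n p) + norm (Q n x - Q n p)"
          by (meson add_right_mono norm_triangle_ineq norm_triangle_ineq4 order_trans)
        also have "\<dots> < r" using tail[of m] tail[of n] n0[OF that] by simp
        finally show ?thesis .
      qed
      then show "\<exists>n0. \<forall>m\<ge>n0. \<forall>n\<ge>n0. norm (Q m x - Q n x) < r" by blast
    qed
    then show ?thesis by (simp add: Cauchy_convergent_iff)
  qed
  define b where "b x = lim (\<lambda>n. Q n x)" for x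
  have b: "(\<lambda>n. Q n x) \<longlonglongrightarrow> b x" for x
    unfolding b_def using lim convergent_LIMSEQ_iff by blast
  have "bounded_linear b"
  proof (rule bounded_linear_intro)
    show "b (x + y) = b x + b y" for x y
      using LIMSEQ_unique[OF b[of "x + y"]] tendsto_add[OF b[of x] b[of y]]
      by (simp add: blinfun.add_right)
    show "b (r *\<^sub>R x) = r *\<^sub>R b x" for r x
      using LIMSEQ_unique[OF b[of "r *\<^sub>R x"]] tendsto_scaleR[OF tendsto_const b[of x], of r]
      by (simp add: blinfun.scaleR_right)
    show "norm (b x) \<le> norm x * M" for x
      by (rule LIMSEQ_le_const2[OF tendsto_norm[OF b]]) (use bound in \<open>auto simp: mult.commute\<close>)
  qed
  then show ?thesis using that[of "Blinfun b"] b by (simp add: bounded_linear_Blinfun_apply)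
qed

text \<open>
  The bound \<open>L\<close> carries no basis constant: the partial sums satisfy
  \<open>norm (Q n z) \<le> L * norm (P n z)\<close>, and \<open>norm (P n z)\<close> tends to \<open>norm z\<close>.
\<close>
lemma synthesis_operator:
  fixes x :: "nat \<Rightarrow> 'b::banach"
  assumes dom: "dominated_by L x e" and L: "L \<ge> 0"
  obtains A where "\<And>k. blinfun_apply A (e k) = x k" "norm A \<le> L"
proof -
  define Q where "Q = partial_sum_op es x"
  have QP: "norm (Q n z) \<le> L * norm (P n z)" for n z
    using dom by (simp add: dominated_by_def Q_def partial_sum_op_apply)
  have Qe: "(\<lambda>n. Q n (e k)) \<longlonglongrightarrow> x k" for k
    by (rule tendsto_eventually)
      (auto simp: eventually_sequentially Q_def partial_sum_op_e Suc_le_eq intro!: exI[of _ "Suc k"])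
  have "norm (Q n z) \<le> (L * lam) * norm z" for n z
    using order_trans[OF QP mult_left_mono[OF norm_P_apply L]] by (simp add: mult.assoc)
  then obtain A where A: "\<And>z. (\<lambda>n. Q n z) \<longlonglongrightarrow> blinfun_apply A z"
    using Qe bounded_limit_operator[of Q "L * lam"] unfolding convergent_def by metis
  have "norm (A z) \<le> L * norm z" for z
    by (rule LIMSEQ_le[OF tendsto_norm[OF A] tendsto_mult[OF tendsto_const tendsto_norm[OF P_tendsto]]])
      (use QP in auto)
  then have "norm A \<le> L" using L by (intro norm_blinfun_bound)
  moreover have "A (e k) = x k" for k using LIMSEQ_unique[OF A Qe] .
  ultimately show ?thesis using that by blast
qed

text \<open>
  Evaluate the norm of the vector \<open>y = (\<Sum>i<n. xs i z * e i)\<close> by a functional \<open>f\<close> that norms it on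
  the span of \<open>e 0, ..., e (n - 1)\<close>. Then \<open>norm y = (\<Sum>i<n. f (e i) * xs i) z\<close>, and domination
  passes to \<open>\<Sum>i<n. f (e i) * es i = f o P n\<close>, whose norm is at most the basis constant.
\<close>
lemma norm_partial_sum_op_dual:
  fixes xs :: "nat \<Rightarrow> 'b::real_normed_vector \<Rightarrow>\<^sub>L real"
  assumes dom: "dominated_by L xs es" and L: "L \<ge> 0"
  shows "norm (partial_sum_op xs e n z) \<le> lam * L * norm z"
proof -
  define y where "y = partial_sum_op xs e n z"
  obtain f where f: "linear f" "f y = norm y" "\<And>x. x \<in> span (e ` {..<n}) \<Longrightarrow> \<bar>f x\<bar> \<le> norm x"
    using norming_functional_on_finite_span[of "e ` {..<n}" y] by auto
  have "norm (\<Sum>i<n. f (e i) *\<^sub>R es i) \<le> lam"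
  proof (rule norm_blinfun_bound)
    fix x
    have "(\<Sum>i<n. f (e i) *\<^sub>R es i) x = f (P n x)"
      by (simp add: partial_sum_op_apply linear_sum[OF f(1)] linear_scale[OF f(1)] blinfun.sum_left
          blinfun.scaleR_left mult.commute)
    also have "\<bar>\<dots>\<bar> \<le> norm (P n x)" using f(3) P_in_span by blast
    also have "\<dots> \<le> lam * norm x" by (rule norm_P_apply)
    finally show "norm ((\<Sum>i<n. f (e i) *\<^sub>R es i) x) \<le> lam * norm x" by simp
  qed (use basis_constant_ge_1 in auto)
  then have xs: "norm (\<Sum>i<n. f (e i) *\<^sub>R xs i) \<le> L * lam"
    using dom L unfolding dominated_by_def by (meson mult_left_mono order_trans)
  have "norm y = (\<Sum>i<n. f (e i) *\<^sub>R xs i) z"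
    unfolding f(2)[symmetric] unfolding y_def
    by (simp add: partial_sum_op_apply linear_sum[OF f(1)] linear_scale[OF f(1)] blinfun.sum_left
          blinfun.scaleR_left mult.commute)
  also have "\<dots> \<le> norm (\<Sum>i<n. f (e i) *\<^sub>R xs i) * norm z"
    using norm_blinfun[of "\<Sum>i<n. f (e i) *\<^sub>R xs i" z] by simp
  also have "\<dots> \<le> (L * lam) * norm z" using xs by (intro mult_right_mono) auto
  finally show ?thesis by (simp add: y_def mult.commute)
qed

text \<open>
  The basis need not be boundedly complete, so bounded partial sums alone do not give convergence.
  The summability assumption provides it on the basis vectors.
\<close>
lemma analysis_operator:
  fixes xs :: "nat \<Rightarrow> 'a \<Rightarrow>\<^sub>L real"
  assumes dom: "dominated_by L xs es" and L: "L \<ge> 0"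
    and small: "\<And>j. summable (\<lambda>k. \<bar>xs k (e j)\<bar>)"
  obtains B where "\<And>z. (\<lambda>k. xs k z *\<^sub>R e k) sums blinfun_apply B z" "norm B \<le> lam * L"
proof -
  define Q where "Q = partial_sum_op xs e"
  have Q: "norm (Q n z) \<le> lam * L * norm z" for n z
    unfolding Q_def by (rule norm_partial_sum_op_dual[OF dom L])
  moreover have "convergent (\<lambda>n. Q n (e j))" for j
  proof -
    have "summable (\<lambda>k. xs k (e j) *\<^sub>R e k)"
      by (rule summable_norm_cancel) (use small[of j] in \<open>simp add: norm_e\<close>)
    then show ?thesis by (simp add: summable_iff_convergent Q_def partial_sum_op_apply)
  qed
  ultimately obtain B where B: "\<And>z. (\<lambda>n. Q n z) \<longlonglongrightarrow> blinfun_apply B z"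
    using bounded_limit_operator[of Q "lam * L"] by metis
  have "norm (B z) \<le> lam * L * norm z" for z
    by (rule LIMSEQ_le_const2[OF tendsto_norm[OF B]]) (use Q in auto)
  then have "norm B \<le> lam * L" using L basis_constant_ge_1 by (intro norm_blinfun_bound) auto
  then show ?thesis using that[of B] B unfolding sums_def Q_def partial_sum_op_apply by blast
qed

text \<open>
  The operator is the sum of the rank-one operators that send \<open>z\<close> to \<open>es k z * r k\<close>; the series
  converges absolutely in operator norm.
\<close>
lemma absolutely_summable_operator:
  fixes r :: "nat \<Rightarrow> 'b::banach"
  assumes sm: "summable (\<lambda>k. norm (r k))"
  obtains R where "\<And>k. blinfun_apply R (e k) = r k" "norm R \<le> 2 * lam * (\<Sum>k. norm (r k))"
proof -
  define F where "F k = blinfun_scaleR_left (r k) o\<^sub>L es k" for k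
  have nF: "norm (F k) \<le> 2 * lam * norm (r k)" for k
  proof (rule norm_blinfun_bound)
    fix x
    have "norm (F k x) = norm (es k x) * norm (r k)" by (simp add: F_def)
    also have "\<dots> \<le> (2 * lam * norm x) * norm (r k)"
      using norm_blinfun[of "es k" x] mult_right_mono[OF norm_es[of k] norm_ge_zero[of x]]
      by (intro mult_right_mono) auto
    finally show "norm (F k x) \<le> 2 * lam * norm (r k) * norm x" by (simp add: mult_ac)
  qed (use basis_constant_ge_1 in auto)
  have sm': "summable (\<lambda>k. 2 * lam * norm (r k))" using sm by (rule summable_mult)
  have snF: "summable (\<lambda>k. norm (F k))"
    by (rule summable_comparison_test'[OF sm', of 0]) (use nF in auto)
  have sF: "F sums suminf F" using snF summable_norm_cancel summable_sums by blast
  have "norm (suminf F) \<le> (\<Sum>k. norm (F k))" by (rule summable_norm[OF snF])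
  also have "\<dots> \<le> (\<Sum>k. 2 * lam * norm (r k))" by (rule suminf_le[OF nF snF sm'])
  also have "\<dots> = 2 * lam * (\<Sum>k. norm (r k))" by (rule suminf_mult[OF sm])
  finally have bound: "norm (suminf F) \<le> 2 * lam * (\<Sum>k. norm (r k))" .
  have "suminf F (e k) = r k" for k
  proof -
    have "(\<lambda>n. F n (e k)) sums suminf F (e k)"
      using bounded_linear.sums[OF blinfun.bounded_linear_left sF] .
    moreover have "(\<lambda>n. F n (e k)) = (\<lambda>n. if n = k then r n else 0)"
      by (auto simp: F_def es_e)
    ultimately show ?thesis using sums_single[of k r] sums_unique2 by metis
  qed
  then show ?thesis using that bound by blast
qed

text \<open>
  The diagonal part \<open>D\<close> is obtained by subtracting from \<open>B T A\<close> its off-diagonal part, which is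
  bounded since its matrix is absolutely summable. A priori a diagonal with bounded entries need not
  define a bounded operator, because the basis may be conditional. The constant 8 collects a factor 2
  from the norm of \<open>es k\<close> and two geometric series of sum 2.
\<close>
lemma almost_diagonal_compression:
  fixes T :: "'a \<Rightarrow>\<^sub>L 'a" and x :: "nat \<Rightarrow> 'a" and xs :: "nat \<Rightarrow> 'a \<Rightarrow>\<^sub>L real"
  assumes x: "dominated_by L x e" and xs: "dominated_by L xs es" and L: "L \<ge> 0"
    and small: "\<And>j. summable (\<lambda>k. \<bar>xs k (e j)\<bar>)"
    and off: "\<And>k m. k \<noteq> m \<Longrightarrow> \<bar>xs m (T (x k))\<bar> \<le> \<tau> * (1/2)^m * (1/2)^k"
  obtains A B D :: "'a \<Rightarrow>\<^sub>L 'a" where "norm A \<le> L" "norm B \<le> lam * L"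
    "\<And>k. blinfun_apply D (e k) = xs k (T (x k)) *\<^sub>R e k"
    "norm ((B o\<^sub>L T o\<^sub>L A) - D) \<le> 8 * lam * \<tau>"
proof -
  obtain A where A: "\<And>k. blinfun_apply A (e k) = x k" "norm A \<le> L"
    using synthesis_operator[OF x L] by blast
  obtain B where B: "\<And>z. (\<lambda>k. xs k z *\<^sub>R e k) sums blinfun_apply B z" "norm B \<le> lam * L"
    using analysis_operator[OF xs L small] by blast
  have geo: "(\<lambda>m. (1/2::real)^m) sums 2" using geometric_sums[of "1/2::real"] by simp
  define r where "r k = B (T (x k)) - xs k (T (x k)) *\<^sub>R e k" for k
  have r: "norm (r k) \<le> 2 * \<tau> * (1/2)^k" for k
  proof -
    define c where "c m = (if m = k then 0 else xs m (T (x k)))" for m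
    have "(\<lambda>m. xs m (T (x k)) *\<^sub>R e m - (if m = k then xs m (T (x k)) *\<^sub>R e m else 0)) sums r k"
      unfolding r_def by (intro sums_diff B(1) sums_single)
    also have "(\<lambda>m. xs m (T (x k)) *\<^sub>R e m - (if m = k then xs m (T (x k)) *\<^sub>R e m else 0))
        = (\<lambda>m. c m *\<^sub>R e m)" by (auto simp: c_def)
    finally have c_sums: "(\<lambda>m. c m *\<^sub>R e m) sums r k" .
    have tau: "\<tau> \<ge> 0" using order_trans[OF abs_ge_zero off[of 0 1]] by simp
    have c_le: "norm (c m *\<^sub>R e m) \<le> \<tau> * (1/2)^k * (1/2)^m" for m
      using off[of k m] tau by (auto simp: c_def norm_e mult_ac)
    have g: "(\<lambda>m. \<tau> * (1/2)^k * (1/2)^m) sums (\<tau> * (1/2)^k * 2)" using geo by (rule sums_mult)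
    have s: "summable (\<lambda>m. norm (c m *\<^sub>R e m))"
      by (rule summable_comparison_test'[OF sums_summable[OF g], of 0]) (use c_le in auto)
    have "norm (r k) \<le> (\<Sum>m. norm (c m *\<^sub>R e m))"
      using summable_norm[OF s] sums_unique[OF c_sums] by simp
    also have "\<dots> \<le> (\<Sum>m. \<tau> * (1/2)^k * (1/2)^m)"
      by (rule suminf_le[OF c_le s sums_summable[OF g]])
    also have "\<dots> = \<tau> * (1/2)^k * 2" using sums_unique[OF g] by simp
    finally show ?thesis by (simp add: mult_ac)
  qed
  have g: "(\<lambda>k. 2 * \<tau> * (1/2)^k) sums (2 * \<tau> * 2)" using geo by (rule sums_mult)
  have s: "summable (\<lambda>k. norm (r k))"
    by (rule summable_comparison_test'[OF sums_summable[OF g], of 0]) (use r in auto)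
  obtain R where R: "\<And>k. blinfun_apply R (e k) = r k" "norm R \<le> 2 * lam * (\<Sum>k. norm (r k))"
    using absolutely_summable_operator[OF s] by blast
  have "(\<Sum>k. norm (r k)) \<le> 4 * \<tau>"
    using suminf_le[OF r s sums_summable[OF g]] sums_unique[OF g] by simp
  then have "2 * lam * (\<Sum>k. norm (r k)) \<le> 2 * lam * (4 * \<tau>)"
    using basis_constant_ge_1 by (intro mult_left_mono) auto
  then have "norm R \<le> 8 * lam * \<tau>" using order_trans[OF R(2)] by (simp add: mult_ac)
  then show ?thesis
    using A B R(1) by (intro that[of A B "(B o\<^sub>L T o\<^sub>L A) - R"])
      (auto simp: r_def blinfun.diff_left)
qed

end

section \<open>Factoring the identity\<close>

lemma id_factors_through_mono:
  "id_factors_through K T \<Longrightarrow> K \<le> K' \<Longrightarrow> id_factors_through K' T"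
  unfolding id_factors_through_def by (meson order_trans)

lemma id_factors_through_nonneg: "id_factors_through K T \<Longrightarrow> K \<ge> 0"
  unfolding id_factors_through_def by (meson mult_nonneg_nonneg norm_ge_zero order_trans)

lemma id_factors_through_scaleR:
  assumes "id_factors_through K (c *\<^sub>R T)" and "c \<ge> 0"
  shows "id_factors_through (c * K) T"
proof -
  obtain R S :: "'a \<Rightarrow>\<^sub>L 'a" where RS: "norm R * norm S \<le> K" "id_blinfun = S o\<^sub>L (c *\<^sub>R T) o\<^sub>L R"
    using assms(1) unfolding id_factors_through_def by blast
  have "S o\<^sub>L (c *\<^sub>R T) o\<^sub>L R = (c *\<^sub>R S) o\<^sub>L T o\<^sub>L R"
    by (rule blinfun_eqI) (simp add: blinfun.scaleR_left blinfun.scaleR_right)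
  moreover have "norm R * norm (c *\<^sub>R S) \<le> c * K"
    using mult_left_mono[OF RS(1) assms(2)] assms(2) by (simp add: mult_ac)
  ultimately show ?thesis using RS(2) unfolding id_factors_through_def by metis
qed

text \<open>
  If \<open>S D R\<close> is the identity, then \<open>S (B T A) R\<close> differs from the identity by at most \<open>q\<close> in norm,
  hence has a left inverse of norm at most \<open>1 / (1 - q)\<close>.
\<close>
lemma id_factors_through_near_compression:
  fixes T D A B :: "'a::banach \<Rightarrow>\<^sub>L 'a"
  assumes D: "id_factors_through K D"
    and near: "norm ((B o\<^sub>L T o\<^sub>L A) - D) * K \<le> q" and q: "q < 1"
  shows "id_factors_through (norm A * norm B * K / (1 - q)) T"
proof -
  obtain R S :: "'a \<Rightarrow>\<^sub>L 'a" where RS: "norm R * norm S \<le> K" "id_blinfun = S o\<^sub>L D o\<^sub>L R"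
    using D unfolding id_factors_through_def by blast
  define V where "V = (B o\<^sub>L T o\<^sub>L A) - D"
  define Q where "Q = S o\<^sub>L B o\<^sub>L T o\<^sub>L A o\<^sub>L R"
  have "id_blinfun - Q = - (S o\<^sub>L V o\<^sub>L R)"
    unfolding RS(2) Q_def V_def
    by (rule blinfun_eqI) (simp add: blinfun.diff_left blinfun.diff_right blinfun.minus_left)
  then have "norm (id_blinfun - Q) = norm (S o\<^sub>L V o\<^sub>L R)" by simp
  also have "\<dots> \<le> (norm S * norm V) * norm R"
    by (meson mult_right_mono norm_blinfun_compose norm_ge_zero order_trans)
  also have "\<dots> \<le> norm V * K" using mult_left_mono[OF RS(1), of "norm V"] by (simp add: mult_ac)
  also have "\<dots> \<le> q" using near by (simp add: V_def)
  finally obtain Q' where Q': "Q' o\<^sub>L Q = id_blinfun" "norm Q' \<le> 1 / (1 - q)"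
    using left_inverse_near_id_blinfun[OF _ q] by blast
  have "norm (A o\<^sub>L R) * norm (Q' o\<^sub>L S o\<^sub>L B)
      \<le> (norm A * norm R) * ((norm Q' * norm S) * norm B)"
    by (intro mult_mono norm_blinfun_compose order_trans[OF norm_blinfun_compose mult_right_mono]) auto
  also have "\<dots> = (norm A * norm B) * (norm Q' * (norm R * norm S))" by (simp add: mult_ac)
  also have "\<dots> \<le> (norm A * norm B) * (1 / (1 - q) * K)"
    using Q'(2) RS(1) q by (intro mult_left_mono mult_mono) auto
  finally have "norm (A o\<^sub>L R) * norm (Q' o\<^sub>L S o\<^sub>L B) \<le> norm A * norm B * K / (1 - q)" by simp
  moreover have "id_blinfun = (Q' o\<^sub>L S o\<^sub>L B) o\<^sub>L T o\<^sub>L (A o\<^sub>L R)"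
    unfolding Q'(1)[symmetric] Q_def by (rule blinfun_eqI) simp
  ultimately show ?thesis unfolding id_factors_through_def by blast
qed

text \<open>
  Apply the property to \<open>\<delta>\<close> times the identity: a constant through which the identity factors is
  never negative.
\<close>
lemma (in schauder_system) diagonal_factorization_constant_nonneg:
  assumes "diagonal_factorization_property e es K" and "\<delta> > 0"
  shows "K \<delta> \<ge> 0"
proof (rule field_le_epsilon)
  fix \<epsilon> :: real assume "\<epsilon> > 0"
  define T :: "'a \<Rightarrow>\<^sub>L 'a" where "T = \<delta> *\<^sub>R id_blinfun"
  have "diagonal_operator e es T"
    by (simp add: diagonal_operator_def T_def blinfun.scaleR_left blinfun.scaleR_right es_e)
  moreover have "(INF n. \<bar>es n (blinfun_apply T (e n))\<bar>) \<ge> \<delta>"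
    using assms(2) by (simp add: T_def blinfun.scaleR_left blinfun.scaleR_right es_e)
  ultimately have "id_factors_through (K \<delta> + \<epsilon>) T"
    using assms \<open>\<epsilon> > 0\<close> unfolding diagonal_factorization_property_def id_almost_factors_through_def
    by blast
  then show "0 \<le> K \<delta> + \<epsilon>" by (rule id_factors_through_nonneg)
qed

theorem theorem3p12:
  fixes e :: "nat \<Rightarrow> 'a::banach"
    and es :: "nat \<Rightarrow> 'a \<Rightarrow>\<^sub>L real"
    and K :: "real \<Rightarrow> real"
    and C :: real
  assumes "schauder_basis e" and "normalized e" and "biorthogonal e es"
    and "C \<ge> 1"
    and "diagonal_factorization_property e es K"
    and "strategically_reproducible e es C"
  shows "factorization_property e es (\<lambda>\<delta>. basis_constant e es * C\<^sup>2 * K \<delta>)"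
  unfolding factorization_property_def id_almost_factors_through_def
proof (intro allI impI)
  interpret schauder_system e es using assms(1-3) by unfold_locales
  fix \<delta> \<epsilon> :: real and T :: "'a \<Rightarrow>\<^sub>L 'a"
  assume \<delta>: "\<delta> > 0" and T: "(INF n. \<bar>es n (blinfun_apply T (e n))\<bar>) \<ge> \<delta>" and \<epsilon>: "\<epsilon> > 0"
  have T_diag: "\<delta> \<le> \<bar>es n (T (e n))\<bar>" for n
    by (rule order_trans[OF T cINF_lower]) (auto intro!: bdd_belowI2[of _ 0])
  have K0: "K \<delta> \<ge> 0" by (rule diagonal_factorization_constant_nonneg[OF assms(5) \<delta>])
  \<comment> \<open>As \<open>\<eta>\<close> tends to 0, the constant obtained below tends to \<open>lam * C * K \<delta>\<close>, and \<open>C \<le> C\<^sup>2\<close>.\<close>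
  obtain \<eta> where \<eta>: "0 < \<eta>" "\<eta> < 1"
    and \<eta>_bound: "lam * (C + \<eta>) * (K \<delta> + \<eta>) / (1 - \<eta>)\<^sup>2 < lam * C\<^sup>2 * K \<delta> + \<epsilon>"
  proof -
    have "((\<lambda>\<eta>. lam * (C + \<eta>) * (K \<delta> + \<eta>) / (1 - \<eta>)\<^sup>2)
        \<longlongrightarrow> lam * (C + 0) * (K \<delta> + 0) / (1 - 0)\<^sup>2) (at_right 0)"
      by (intro tendsto_intros) auto
    moreover have "lam * (C + 0) * (K \<delta> + 0) / (1 - 0)\<^sup>2 < lam * C\<^sup>2 * K \<delta> + \<epsilon>"
    proof -
      have "C \<le> C\<^sup>2" using assms(4) by (simp add: power2_eq_square)
      then have "lam * C * K \<delta> \<le> lam * C\<^sup>2 * K \<delta>"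
        using basis_constant_ge_1 K0 by (intro mult_right_mono mult_left_mono) auto
      then show ?thesis using \<epsilon> by simp
    qed
    ultimately have "\<forall>\<^sub>F \<eta> in at_right 0.
        lam * (C + \<eta>) * (K \<delta> + \<eta>) / (1 - \<eta>)\<^sup>2 < lam * C\<^sup>2 * K \<delta> + \<epsilon>"
      by (rule order_tendstoD(2))
    moreover have "\<forall>\<^sub>F \<eta> in at_right (0::real). \<eta> \<in> {0<..<1}"
      by (rule eventually_at_right_real) simp
    ultimately have "\<forall>\<^sub>F \<eta> in at_right 0. \<eta> \<in> {0<..<1} \<and>
        lam * (C + \<eta>) * (K \<delta> + \<eta>) / (1 - \<eta>)\<^sup>2 < lam * C\<^sup>2 * K \<delta> + \<epsilon>"
      by eventually_elim simp
    then have "\<exists>\<eta>. \<eta> \<in> {0<..<1} \<and>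
        lam * (C + \<eta>) * (K \<delta> + \<eta>) / (1 - \<eta>)\<^sup>2 < lam * C\<^sup>2 * K \<delta> + \<epsilon>"
      by (rule eventually_happens'[OF trivial_limit_at_right_real])
    then show ?thesis by (elim exE conjE) (intro that, auto)
  qed
  define L where "L = sqrt (C + \<eta>)"
  have L: "L \<ge> 0" "L * L = C + \<eta>" using \<eta> assms(4) by (auto simp: L_def)
  \<comment> \<open>A common bound for \<open>norm (T (x k))\<close> and \<open>norm (xs k o\<^sub>L T)\<close>; adding 1 keeps it positive.\<close>
  define c where "c = 2 * lam * L * norm T + 1"
  have c: "c > 0" using basis_constant_ge_1 L by (simp add: c_def add_nonneg_pos)
  \<comment> \<open>Chosen such that the error \<open>8 * lam * \<tau>\<close> times the constant for \<open>D\<close> is \<open>\<eta>\<close>.\<close>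
  define \<tau> where "\<tau> = \<eta> * (1 - \<eta>) / (8 * lam * (K \<delta> + \<eta>))"
  have \<tau>: "\<tau> > 0" using \<eta> K0 basis_constant_ge_1 by (simp add: \<tau>_def)
  \<comment> \<open>Powers of \<open>1/4\<close>, since \<open>(1/4)^max m k\<close> is at most \<open>(1/2)^m * (1/2)^k\<close>, a double geometric series.\<close>
  define tol where "tol k = \<tau> / c * (1/4)^k" for k :: nat
  have tol: "tol k > 0" for k using \<tau> c by (simp add: tol_def)
  obtain \<sigma> where \<sigma>: "winning_strategy e es C \<eta> \<sigma>"
    using assms(6) \<eta>(1) unfolding strategically_reproducible_def by blast
  obtain x :: "nat \<Rightarrow> 'a" and xs :: "nat \<Rightarrow> 'a \<Rightarrow>\<^sub>L real" where
    equiv: "impartially_equivalent (C + \<eta>) x e" "impartially_equivalent (C + \<eta>) xs es"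
    and diag: "\<And>k. \<delta> * (1 - \<eta>) \<le> \<bar>xs k (T (x k))\<bar>"
    and up: "\<And>j k. j < k \<Longrightarrow> \<bar>xs j (T (x k))\<bar> \<le> tol k * norm (xs j o\<^sub>L T)"
    and down: "\<And>j k. j < k \<Longrightarrow> \<bar>xs k (T (x j))\<bar> \<le> tol k * norm (T (x j))"
    and head: "\<And>j k. j < k \<Longrightarrow> \<bar>xs k (e j)\<bar> \<le> tol k * norm (e j)"
    using winning_play_almost_biorthogonal[where tol = tol, OF \<sigma> T_diag less_imp_le[OF \<delta>] tol] by metis
  have dom: "dominated_by L x e" "dominated_by L xs es"
    using equiv[THEN impartially_equivalent_imp_dominated_by] by (simp_all add: L_def)
  have x_le: "norm (x k) \<le> L" for k using dominated_by_norm[OF dom(1), of k] by (simp add: norm_e)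
  have xs_le: "norm (xs k) \<le> 2 * lam * L" for k
    using order_trans[OF dominated_by_norm[OF dom(2)] mult_left_mono[OF norm_es L(1)]]
    by (simp add: mult_ac)
  have "norm (T (x k)) \<le> c" for k
  proof -
    have "norm (T (x k)) \<le> norm T * norm (x k)" by (rule norm_blinfun)
    also have "\<dots> \<le> norm T * (2 * lam * L)"
      using x_le[of k] L basis_constant_ge_1 mult_right_mono[of 1 "2 * lam" L]
      by (intro mult_left_mono) auto
    finally show ?thesis by (simp add: c_def mult_ac)
  qed
  moreover have "norm (xs k o\<^sub>L T) \<le> c" for k
    using order_trans[OF norm_blinfun_compose mult_right_mono[OF xs_le norm_ge_zero], of k T]
    by (simp add: c_def)
  moreover have "tol k * c \<le> \<tau> * (1/2)^k * (1/2)^j" if "j \<le> k" for j k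
  proof -
    have "(1/4::real)^k = (1/2)^k * (1/2)^k" by (simp flip: power_mult_distrib)
    also have "\<dots> \<le> (1/2)^k * (1/2)^j" using that by (intro mult_left_mono power_decreasing) auto
    finally show ?thesis using c \<tau> by (simp add: tol_def mult.assoc)
  qed
  ultimately have
    "tol k * norm (T (x j)) \<le> \<tau> * (1/2)^k * (1/2)^j"
    "tol k * norm (xs j o\<^sub>L T) \<le> \<tau> * (1/2)^k * (1/2)^j" if "j < k" for j k
    using that tol[of k] by (meson less_imp_le mult_left_mono order_trans)+
  then have off: "\<bar>xs m (T (x k))\<bar> \<le> \<tau> * (1/2)^m * (1/2)^k" if "k \<noteq> m" for k m
    using that up[of m k] down[of k m] by (cases k m rule: linorder_cases) (force simp: mult_ac)+
  have small: "summable (\<lambda>k. \<bar>xs k (e j)\<bar>)" for j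
  proof (rule summable_comparison_test'[of tol "Suc j"])
    show "summable tol" unfolding tol_def by (intro summable_mult summable_geometric) simp
    show "norm \<bar>xs k (e j)\<bar> \<le> tol k" if "k \<ge> Suc j" for k
      using head[of j k] that by (simp add: norm_e)
  qed
  obtain A B D where A: "norm A \<le> L" and B: "norm B \<le> lam * L"
    and D: "\<And>k. blinfun_apply D (e k) = xs k (T (x k)) *\<^sub>R e k"
    and near: "norm ((B o\<^sub>L T o\<^sub>L A) - D) \<le> 8 * lam * \<tau>"
    using almost_diagonal_compression[OF dom L(1) small off] by metis
  \<comment> \<open>The diagonal of \<open>D\<close> is bounded below by \<open>\<delta> * (1 - \<eta>)\<close> only; rescaling restores \<open>\<delta>\<close>.\<close>
  define D' where "D' = (1 / (1 - \<eta>)) *\<^sub>R D"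
  have "diagonal_operator e es D'"
    by (simp add: diagonal_operator_def D'_def D blinfun.scaleR_left blinfun.scaleR_right es_e)
  moreover have "(INF n. \<bar>es n (blinfun_apply D' (e n))\<bar>) \<ge> \<delta>"
    using diag \<eta> by (intro cINF_greatest)
      (auto simp: D'_def D blinfun.scaleR_left blinfun.scaleR_right es_e abs_mult field_simps)
  ultimately have "id_factors_through (K \<delta> + \<eta>) D'"
    using assms(5) \<delta> \<eta>(1)
    unfolding diagonal_factorization_property_def id_almost_factors_through_def by blast
  then have fD: "id_factors_through (1 / (1 - \<eta>) * (K \<delta> + \<eta>)) D"
    unfolding D'_def using \<eta> by (intro id_factors_through_scaleR) auto
  have "norm ((B o\<^sub>L T o\<^sub>L A) - D) * (1 / (1 - \<eta>) * (K \<delta> + \<eta>))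
      \<le> 8 * lam * \<tau> * (1 / (1 - \<eta>) * (K \<delta> + \<eta>))"
    using near \<eta> K0 by (intro mult_right_mono) auto
  also have "\<dots> = \<eta>"
  proof -
    have "8 * l * (\<eta> * u / (8 * l * w)) * (1 / u * w) = \<eta>" if "l \<noteq> 0" "u \<noteq> 0" "w \<noteq> 0"
      for l u w :: real using that by simp
    then show ?thesis unfolding \<tau>_def using \<eta> K0 basis_constant_ge_1 by simp
  qed
  finally have "id_factors_through
      (norm A * norm B * (1 / (1 - \<eta>) * (K \<delta> + \<eta>)) / (1 - \<eta>)) T"
    by (rule id_factors_through_near_compression[OF fD _ \<eta>(2)])
  moreover have "norm A * norm B * (1 / (1 - \<eta>) * (K \<delta> + \<eta>)) / (1 - \<eta>)
      \<le> lam * C\<^sup>2 * K \<delta> + \<epsilon>"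
  proof -
    have "norm A * norm B \<le> L * (lam * L)" using A B L by (intro mult_mono) auto
    also have "\<dots> = lam * (C + \<eta>)" using L(2) by (simp add: mult_ac)
    finally have "norm A * norm B * (1 / (1 - \<eta>) * (K \<delta> + \<eta>)) / (1 - \<eta>)
        \<le> lam * (C + \<eta>) * (1 / (1 - \<eta>) * (K \<delta> + \<eta>)) / (1 - \<eta>)"
      using \<eta> K0 by (intro divide_right_mono mult_right_mono) auto
    also have "\<dots> = lam * (C + \<eta>) * (K \<delta> + \<eta>) / (1 - \<eta>)\<^sup>2"
      by (simp add: power2_eq_square)
    finally show ?thesis using \<eta>_bound by simp
  qed
  ultimately show "id_factors_through (lam * C\<^sup>2 * K \<delta> + \<epsilon>) T"
    by (rule id_factors_through_mono)
qed

end
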